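(* Let $A$ be a finite abelian group. Then the canonical bilinear map $\otimes\colon A\times A\rightarrow A\otimes A$, $(a,b)\mapsto a\otimes b$, is non-degenerate.
   Context: $A\otimes A$ denotes the tensor product $A\otimes_{\mathbb{Z}}A$ of abelian groups, and the canonical bilinear map sends $(a,b)$ to the elementary tensor $a\otimes b$. For abelian groups $A,B,C$ (written additively), a bilinear map $f\colon A\times B\to C$ is left non-degenerate if $f(a,b)=0_C$ for every $b\in B$ implies $a=0_A$; right non-degenerate if $f(a,b)=0_C$ for every $a\in A$ implies $b=0_B$; and non-degenerate if it is both left and right non-degenerate. *)

theory Defs
  imports "HOL-Algebra.Algebra"
begin

text \<open>
  Abelian groups are commutative groups in the sense of HOL-Algebra, so the operation is written
  multiplicatively: the additive \<open>a + a'\<close> and \<open>0\<close> of \<open>A\<close> are \<open>a \<otimes>\<^bsub>A\<^esub> a'\<close> and \<open>\<one>\<^bsub>A\<^esub>\<close>.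
  The library operator \<open>\<otimes>\<close> is this group operation and never an elementary tensor.
  Maps on a product \<open>A \<times> B\<close> are curried.
\<close>

subsection \<open>Bilinear maps\<close>

definition bilinear_map ::
  "('a, 'm) monoid_scheme \<Rightarrow> ('b, 'n) monoid_scheme \<Rightarrow> ('c, 'k) monoid_scheme
    \<Rightarrow> ('a \<Rightarrow> 'b \<Rightarrow> 'c) \<Rightarrow> bool"
  where "bilinear_map A B C f \<longleftrightarrow>
    (\<forall>a \<in> carrier A. (\<lambda>b. f a b) \<in> hom B C) \<and> (\<forall>b \<in> carrier B. (\<lambda>a. f a b) \<in> hom A C)"

definition left_nondegenerate ::
  "('a, 'm) monoid_scheme \<Rightarrow> ('b, 'n) monoid_scheme \<Rightarrow> ('c, 'k) monoid_scheme
    \<Rightarrow> ('a \<Rightarrow> 'b \<Rightarrow> 'c) \<Rightarrow> bool"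
  where "left_nondegenerate A B C f \<longleftrightarrow>
    (\<forall>a \<in> carrier A. (\<forall>b \<in> carrier B. f a b = \<one>\<^bsub>C\<^esub>) \<longrightarrow> a = \<one>\<^bsub>A\<^esub>)"

definition right_nondegenerate ::
  "('a, 'm) monoid_scheme \<Rightarrow> ('b, 'n) monoid_scheme \<Rightarrow> ('c, 'k) monoid_scheme
    \<Rightarrow> ('a \<Rightarrow> 'b \<Rightarrow> 'c) \<Rightarrow> bool"
  where "right_nondegenerate A B C f \<longleftrightarrow>
    (\<forall>b \<in> carrier B. (\<forall>a \<in> carrier A. f a b = \<one>\<^bsub>C\<^esub>) \<longrightarrow> b = \<one>\<^bsub>B\<^esub>)"

definition nondegenerate ::
  "('a, 'm) monoid_scheme \<Rightarrow> ('b, 'n) monoid_scheme \<Rightarrow> ('c, 'k) monoid_scheme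
    \<Rightarrow> ('a \<Rightarrow> 'b \<Rightarrow> 'c) \<Rightarrow> bool"
  where "nondegenerate A B C f \<longleftrightarrow> left_nondegenerate A B C f \<and> right_nondegenerate A B C f"

subsection \<open>Tensor product over the integers\<close>

text \<open>
  The usual construction: the free abelian group on \<open>A \<times> B\<close> modulo the subgroup generated by
  \<open>(a + a', b) - (a, b) - (a', b)\<close> and \<open>(a, b + b') - (a, b) - (a, b')\<close>.
  Compatibility with integer scalars follows from additivity.
\<close>

definition tensor_relations ::
  "('a, 'm) monoid_scheme \<Rightarrow> ('b, 'n) monoid_scheme \<Rightarrow> ('a \<times> 'b \<Rightarrow>\<^sub>0 int) set"
  where "tensor_relations A B =
    {frag_of (a \<otimes>\<^bsub>A\<^esub> a', b) - frag_of (a, b) - frag_of (a', b) | a a' b.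
       a \<in> carrier A \<and> a' \<in> carrier A \<and> b \<in> carrier B} \<union>
    {frag_of (a, b \<otimes>\<^bsub>B\<^esub> b') - frag_of (a, b) - frag_of (a, b') | a b b'.
       a \<in> carrier A \<and> b \<in> carrier B \<and> b' \<in> carrier B}"

definition tensor_kernel ::
  "('a, 'm) monoid_scheme \<Rightarrow> ('b, 'n) monoid_scheme \<Rightarrow> ('a \<times> 'b \<Rightarrow>\<^sub>0 int) set"
  where "tensor_kernel A B =
    generate (free_Abelian_group (carrier A \<times> carrier B)) (tensor_relations A B)"

definition tensor_product ::
  "('a, 'm) monoid_scheme \<Rightarrow> ('b, 'n) monoid_scheme \<Rightarrow> ('a \<times> 'b \<Rightarrow>\<^sub>0 int) set monoid"
  where "tensor_product A B =
    free_Abelian_group (carrier A \<times> carrier B) Mod tensor_kernel A B"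

definition elementary_tensor ::
  "('a, 'm) monoid_scheme \<Rightarrow> ('b, 'n) monoid_scheme \<Rightarrow> 'a \<Rightarrow> 'b \<Rightarrow> ('a \<times> 'b \<Rightarrow>\<^sub>0 int) set"
  where "elementary_tensor A B a b =
    tensor_kernel A B #>\<^bsub>free_Abelian_group (carrier A \<times> carrier B)\<^esub> frag_of (a, b)"

lemma tensor_relations_subset:
  assumes "comm_group A" "comm_group B"
  shows "tensor_relations A B \<subseteq> carrier (free_Abelian_group (carrier A \<times> carrier B))"
proof
  interpret A: comm_group A by fact
  interpret B: comm_group B by fact
  let ?F = "free_Abelian_group (carrier A \<times> carrier B)"
  have diff: "x - y \<in> carrier ?F" if "x \<in> carrier ?F" "y \<in> carrier ?F" for x y
    using that keys_diff[of x y] by auto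
  fix x assume "x \<in> tensor_relations A B"
  then show "x \<in> carrier ?F"
    unfolding tensor_relations_def
    by (elim UnE CollectE exE conjE; simp only:; intro diff) auto
qed

lemma tensor_kernel_subgroup:
  assumes "comm_group A" "comm_group B"
  shows "subgroup (tensor_kernel A B) (free_Abelian_group (carrier A \<times> carrier B))"
  unfolding tensor_kernel_def
  by (rule group.generate_is_subgroup[OF group_free_Abelian_group tensor_relations_subset[OF assms]])

lemma comm_group_tensor_product:
  assumes "comm_group A" "comm_group B"
  shows "comm_group (tensor_product A B)"
  unfolding tensor_product_def
  by (rule comm_group.abelian_FactGroup[OF abelian_free_Abelian_group tensor_kernel_subgroup[OF assms]])

lemma tensor_projection_hom:
  assumes "comm_group A" "comm_group B"
  shows "(\<lambda>x. tensor_kernel A B #>\<^bsub>free_Abelian_group (carrier A \<times> carrier B)\<^esub> x)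
    \<in> hom (free_Abelian_group (carrier A \<times> carrier B)) (tensor_product A B)"
  unfolding tensor_product_def
  by (intro normal.r_coset_hom_Mod comm_group.subgroup_imp_normal[OF abelian_free_Abelian_group]
      tensor_kernel_subgroup[OF assms])

lemma bilinear_map_elementary_tensor:
  assumes "comm_group A" "comm_group B"
  shows "bilinear_map A B (tensor_product A B) (elementary_tensor A B)"
proof -
  interpret A: comm_group A by fact
  interpret B: comm_group B by fact
  let ?F = "free_Abelian_group (carrier A \<times> carrier B)"
  let ?p = "\<lambda>x. tensor_kernel A B #>\<^bsub>?F\<^esub> x"
  let ?T = "tensor_product A B"
  interpret T: comm_group ?T by (rule comm_group_tensor_product[OF assms])
  note hom = tensor_projection_hom[OF assms]
  have sub: "subgroup (tensor_kernel A B) ?F" by (rule tensor_kernel_subgroup[OF assms])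
  have ker: "?p r = \<one>\<^bsub>?T\<^esub>" if "r \<in> tensor_relations A B" for r
  proof -
    have r: "r \<in> tensor_kernel A B"
      unfolding tensor_kernel_def using that by (rule generate.incl)
    then have "?p r = tensor_kernel A B"
      using group.coset_join2[OF group_free_Abelian_group _ sub r] subgroup.subset[OF sub]
      by blast
    then show ?thesis by (simp add: tensor_product_def FactGroup_def)
  qed
  have add: "?p x = ?p y \<otimes>\<^bsub>?T\<^esub> ?p z"
    if "x - y - z \<in> tensor_relations A B" "y \<in> carrier ?F" "z \<in> carrier ?F" for x y z
  proof -
    have r: "x - y - z \<in> carrier ?F" using that tensor_relations_subset[OF assms] by blast
    have yz: "y \<otimes>\<^bsub>?F\<^esub> z \<in> carrier ?F"
      using that group.is_monoid[OF group_free_Abelian_group] by (intro monoid.m_closed)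
    have "?p ((x - y - z) \<otimes>\<^bsub>?F\<^esub> (y \<otimes>\<^bsub>?F\<^esub> z)) = ?p (x - y - z) \<otimes>\<^bsub>?T\<^esub> (?p y \<otimes>\<^bsub>?T\<^esub> ?p z)"
      using hom_mult[OF hom r yz] hom_mult[OF hom that(2,3)] by simp
    also have "\<dots> = ?p y \<otimes>\<^bsub>?T\<^esub> ?p z"
      using ker[OF that(1)] hom_in_carrier[OF hom] that by simp
    finally show ?thesis by (simp add: algebra_simps)
  qed
  have closed: "?p (frag_of (a, b)) \<in> carrier ?T" if "a \<in> carrier A" "b \<in> carrier B" for a b
    using that by (intro hom_in_carrier[OF hom]) simp
  show ?thesis
    unfolding bilinear_map_def elementary_tensor_def
  proof (intro conjI ballI homI add closed; (simp only: frag_of_in_free_Abelian_group)?)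
    fix a b b' assume "a \<in> carrier A" "b \<in> carrier B" "b' \<in> carrier B"
    then show "frag_of (a, b \<otimes>\<^bsub>B\<^esub> b') - frag_of (a, b) - frag_of (a, b') \<in> tensor_relations A B"
      unfolding tensor_relations_def by blast
  next
    fix b a a' assume "a \<in> carrier A" "a' \<in> carrier A" "b \<in> carrier B"
    then show "frag_of (a \<otimes>\<^bsub>A\<^esub> a', b) - frag_of (a, b) - frag_of (a', b) \<in> tensor_relations A B"
      unfolding tensor_relations_def by blast
  qed auto
qed

lemma tensor_product_universal:
  assumes "comm_group A" "comm_group B" "comm_group C" and f: "bilinear_map A B C f"
  obtains h where "h \<in> hom (tensor_product A B) C"
    and "\<And>a b. a \<in> carrier A \<Longrightarrow> b \<in> carrier B \<Longrightarrow> h (elementary_tensor A B a b) = f a b"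
proof -
  interpret A: comm_group A by fact
  interpret B: comm_group B by fact
  interpret C: comm_group C by fact
  let ?F = "free_Abelian_group (carrier A \<times> carrier B)"
  have fC: "f a b \<in> carrier C" if "a \<in> carrier A" "b \<in> carrier B" for a b
    using f that unfolding bilinear_map_def by (metis hom_in_carrier)
  have fl: "f (a \<otimes>\<^bsub>A\<^esub> a') b = f a b \<otimes>\<^bsub>C\<^esub> f a' b"
    if "a \<in> carrier A" "a' \<in> carrier A" "b \<in> carrier B" for a a' b
  proof -
    have "(\<lambda>a. f a b) \<in> hom A C" using f that unfolding bilinear_map_def by blast
    from hom_mult[OF this that(1,2)] show ?thesis .
  qed
  have fr: "f a (b \<otimes>\<^bsub>B\<^esub> b') = f a b \<otimes>\<^bsub>C\<^esub> f a b'"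
    if "a \<in> carrier A" "b \<in> carrier B" "b' \<in> carrier B" for a b b'
  proof -
    have "(\<lambda>b. f a b) \<in> hom B C" using f that unfolding bilinear_map_def by blast
    from hom_mult[OF this that(2,3)] show ?thesis .
  qed
  have "case_prod f ` (carrier A \<times> carrier B) \<subseteq> carrier C" using fC by auto
  then obtain g where g: "g \<in> hom ?F C"
      and gf: "\<And>p. p \<in> carrier A \<times> carrier B \<Longrightarrow> g (frag_of p) = case_prod f p"
    by (rule C.free_Abelian_group_universal) blast
  interpret g: group_hom ?F C g
    using g by (simp add: group_hom_def group_hom_axioms_def C.group_axioms)
  have rel: "g (frag_of p - frag_of q - frag_of r) = \<one>\<^bsub>C\<^esub>"
    if "p \<in> carrier A \<times> carrier B" "q \<in> carrier A \<times> carrier B" "r \<in> carrier A \<times> carrier B"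
      "case_prod f p = case_prod f q \<otimes>\<^bsub>C\<^esub> case_prod f r" for p q r
  proof -
    let ?r = "frag_of p - frag_of q - frag_of r"
    have eq: "?r \<otimes>\<^bsub>?F\<^esub> (frag_of q \<otimes>\<^bsub>?F\<^esub> frag_of r) = frag_of p" by simp
    have qr: "frag_of q \<in> carrier ?F" "frag_of r \<in> carrier ?F" using that by simp_all
    have "?r = frag_of p \<otimes>\<^bsub>?F\<^esub> inv\<^bsub>?F\<^esub> (frag_of q) \<otimes>\<^bsub>?F\<^esub> inv\<^bsub>?F\<^esub> (frag_of r)"
      using that by simp
    also have "\<dots> \<in> carrier ?F"
      using that by (intro g.G.m_closed g.G.inv_closed) simp_all
    finally have r: "?r \<in> carrier ?F" .
    have "g ?r \<otimes>\<^bsub>C\<^esub> (g (frag_of q) \<otimes>\<^bsub>C\<^esub> g (frag_of r)) = g (frag_of p)"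
      using g.hom_mult[OF r g.G.m_closed[OF qr]] g.hom_mult[OF qr] eq by simp
    then show ?thesis
      using that gf g.hom_closed[OF r] g.hom_closed[OF qr(1)] g.hom_closed[OF qr(2)]
      by (metis C.l_cancel_one C.m_closed C.r_cancel_one)
  qed
  have "tensor_relations A B \<subseteq> kernel ?F C g"
  proof
    fix x assume x: "x \<in> tensor_relations A B"
    then have "x \<in> carrier ?F" using tensor_relations_subset[OF assms(1,2)] by blast
    moreover have "g x = \<one>\<^bsub>C\<^esub>"
      using x unfolding tensor_relations_def by (auto intro!: rel simp: fl fr)
    ultimately show "x \<in> kernel ?F C g" by (simp add: kernel_def)
  qed
  then have "tensor_kernel A B \<subseteq> kernel ?F C g"
    unfolding tensor_kernel_def
    by (rule g.G.generate_subgroup_incl[OF _ g.subgroup_kernel])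
  moreover have "tensor_kernel A B \<lhd> ?F"
    by (rule comm_group.subgroup_imp_normal[OF abelian_free_Abelian_group
          tensor_kernel_subgroup[OF assms(1,2)]])
  ultimately obtain h where "h \<in> hom (?F Mod tensor_kernel A B) C"
      and "\<And>x. x \<in> carrier ?F \<Longrightarrow> h (tensor_kernel A B #>\<^bsub>?F\<^esub> x) = g x"
    using g.FactGroup_universal_kernel by blast
  then show thesis
    using gf by (intro that[of h]) (simp_all add: tensor_product_def elementary_tensor_def)
qed

lemma tensor_product_hom_eqI:
  assumes "comm_group A" "comm_group B" "comm_group C"
    and h: "h \<in> hom (tensor_product A B) C" and h': "h' \<in> hom (tensor_product A B) C"
    and eq: "\<And>a b. a \<in> carrier A \<Longrightarrow> b \<in> carrier B
      \<Longrightarrow> h (elementary_tensor A B a b) = h' (elementary_tensor A B a b)"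
    and t: "t \<in> carrier (tensor_product A B)"
  shows "h t = h' t"
proof -
  interpret C: comm_group C by fact
  let ?F = "free_Abelian_group (carrier A \<times> carrier B)"
  let ?p = "\<lambda>x. tensor_kernel A B #>\<^bsub>?F\<^esub> x"
  have p: "?p \<in> hom ?F (tensor_product A B)" by (rule tensor_projection_hom[OF assms(1,2)])
  have hp: "(\<lambda>x. h (?p x)) \<in> hom ?F C" "(\<lambda>x. h' (?p x)) \<in> hom ?F C"
    using hom_compose[OF p h] hom_compose[OF p h'] by (simp_all add: o_def)
  interpret u: group_hom ?F C "\<lambda>x. h (?p x)"
    using hp by (simp add: group_hom_def group_hom_axioms_def C.group_axioms)
  interpret v: group_hom ?F C "\<lambda>x. h' (?p x)"
    using hp by (simp add: group_hom_def group_hom_axioms_def C.group_axioms)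
  obtain x where x: "x \<in> carrier ?F" "t = ?p x"
    using t unfolding tensor_product_def FactGroup_def RCOSETS_def by auto
  have "h (?p x) = h' (?p x)"
  proof (rule free_Abelian_group_induct[where x = x and S = "carrier A \<times> carrier B"])
    show "Poly_Mapping.keys x \<subseteq> carrier A \<times> carrier B" using x by simp
    show "h (?p 0) = h' (?p 0)" using u.hom_one v.hom_one by simp
    show "h (?p (frag_of ab)) = h' (?p (frag_of ab))" if "ab \<in> carrier A \<times> carrier B" for ab
      using eq that unfolding elementary_tensor_def by force
    show "h (?p (y - z)) = h' (?p (y - z))"
      if yz: "Poly_Mapping.keys y \<subseteq> carrier A \<times> carrier B" "Poly_Mapping.keys z \<subseteq> carrier A \<times> carrier B"
        and "h (?p y) = h' (?p y)" "h (?p z) = h' (?p z)" for y z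
    proof -
      have "y \<in> carrier ?F" "z \<in> carrier ?F" using yz by simp_all
      moreover have "y - z = y \<otimes>\<^bsub>?F\<^esub> inv\<^bsub>?F\<^esub> z" using yz by simp
      ultimately show ?thesis
        using that by (simp only: u.hom_mult v.hom_mult u.G.inv_closed u.hom_inv v.hom_inv)
    qed
  qed
  then show ?thesis using x by simp
qed

end

theory Submission
  imports Defs "HOL-Number_Theory.Cong"
begin

text \<open>
  Let \<open>e\<close> be the exponent of \<open>A\<close>. The group \<open>\<int>/e\<close> is injective among abelian groups killed by \<open>e\<close>,
  so for \<open>a \<noteq> 0\<close> there is a homomorphism \<open>\<chi>: A \<rightarrow> \<int>/e\<close> with \<open>\<chi>(a) \<noteq> 0\<close>. Now \<open>(x, y) \<mapsto> \<chi>(x) y\<close> is a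
  well-defined bilinear map \<open>A \<times> A \<rightarrow> A\<close>, and it does not vanish identically at \<open>x = a\<close> because \<open>e\<close>
  does not divide \<open>\<chi>(a)\<close>. It factors through \<open>A \<otimes> A\<close>, so \<open>a \<otimes> y \<noteq> 0\<close> for some \<open>y\<close>.
\<close>

text \<open>
  A homomorphism into \<open>\<int>/e\<close> is represented by integer representatives of its values.
\<close>

definition hom_mod :: "int \<Rightarrow> ('a, 'm) monoid_scheme \<Rightarrow> 'a set \<Rightarrow> ('a \<Rightarrow> int) \<Rightarrow> bool"
  where "hom_mod e G H \<chi> \<longleftrightarrow> (\<forall>x\<in>H. \<forall>y\<in>H. [\<chi> (x \<otimes>\<^bsub>G\<^esub> y) = \<chi> x + \<chi> y] (mod e))"

lemma hom_modD:
  "hom_mod e G H \<chi> \<Longrightarrow> x \<in> H \<Longrightarrow> y \<in> H \<Longrightarrow> [\<chi> (x \<otimes>\<^bsub>G\<^esub> y) = \<chi> x + \<chi> y] (mod e)"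
  by (simp add: hom_mod_def)

section \<open>Homomorphisms modulo \<open>e\<close> on subgroups and their extension\<close>

context comm_group
begin

lemma hom_mod_one:
  assumes "subgroup H G" "hom_mod e G H \<chi>"
  shows "[\<chi> \<one> = 0] (mod e)"
  using hom_modD[OF assms(2), of \<one> \<one>] subgroup.one_closed[OF assms(1)]
  by (simp add: cong_iff_dvd_diff)

lemma hom_mod_nat_pow:
  assumes "subgroup H G" "hom_mod e G H \<chi>" "x \<in> H"
  shows "[\<chi> (x [^] n) = int n * \<chi> x] (mod e)"
proof (induction n)
  case 0
  then show ?case using hom_mod_one[OF assms(1,2)] by simp
next
  case (Suc n)
  have "x [^] n \<in> H"
    using subgroup_int_pow_closed[OF assms(1,3), of "int n"] by (simp add: int_pow_int)
  then have "[\<chi> (x [^] Suc n) = \<chi> (x [^] n) + \<chi> x] (mod e)"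
    using hom_modD[OF assms(2) _ assms(3)] by simp
  also have "[\<chi> (x [^] n) + \<chi> x = int n * \<chi> x + \<chi> x] (mod e)"
    using Suc by (intro cong_add) auto
  finally show ?case by (simp add: algebra_simps)
qed

text \<open>One-element extension with prescribed value \<open>d\<close> at \<open>x\<close>: send
  \<open>h \<otimes> x [^] k\<close> to \<open>\<chi> h + k * d\<close>. The hypothesis on
  \<open>d\<close> says that this agrees with \<open>\<chi>\<close> on the powers of
  \<open>x\<close> lying in \<open>H\<close>, which is exactly what makes the residue modulo
  \<open>e\<close> independent of the representation.\<close>

lemma hom_mod_extend:
  assumes H: "subgroup H G" and \<chi>: "hom_mod e G H \<chi>" and x: "x \<in> carrier G"
    and d: "\<And>k::int. x [^] k \<in> H \<Longrightarrow> [\<chi> (x [^] k) = k * d] (mod e)"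
  obtains K \<psi> where "subgroup K G" "hom_mod e G K \<psi>" "H \<subseteq> K" "x \<in> K"
    "\<And>h. h \<in> H \<Longrightarrow> [\<psi> h = \<chi> h] (mod e)" "[\<psi> x = d] (mod e)"
proof -
  interpret H: subgroup H G by fact
  define K where "K = {h \<otimes> x [^] k | h (k::int). h \<in> H}"
  \<comment> \<open>The choice fixes one representation of \<open>y\<close>. Only the residue of the
    value modulo \<open>e\<close> is independent of it, as the next fact shows; outside
    \<open>K\<close> the value is arbitrary.\<close>
  define \<psi> where "\<psi> y = (let (h, k) = SOME (h, k). h \<in> H \<and> y = h \<otimes> x [^] (k::int) in \<chi> h + k * d)" for y
  have \<psi>: "[\<psi> (h \<otimes> x [^] k) = \<chi> h + k * d] (mod e)" if h: "h \<in> H" for h and k :: int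
  proof -
    obtain h' and k' :: int where hk: "h' \<in> H" "h \<otimes> x [^] k = h' \<otimes> x [^] k'"
      and \<psi>': "\<psi> (h \<otimes> x [^] k) = \<chi> h' + k' * d"
      using someI[of "\<lambda>(h', k'). h' \<in> H \<and> h \<otimes> x [^] k = h' \<otimes> x [^] (k'::int)" "(h, k)"] h
      unfolding \<psi>_def by (auto split: prod.splits)
    \<comment> \<open>Two representations of the same element differ by
      \<open>x [^] (k - k')\<close>, which therefore lies in \<open>H\<close>, where the hypothesis
      on \<open>d\<close> applies.\<close>
    have "h \<otimes> x [^] (k - k') = h \<otimes> (x [^] k \<otimes> inv (x [^] k'))"
      using x by (simp add: int_pow_diff)
    also have "\<dots> = h' \<otimes> (x [^] k' \<otimes> inv (x [^] k'))"
      using hk h x by (metis H.mem_carrier int_pow_closed inv_closed m_assoc)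
    finally have h': "h \<otimes> x [^] (k - k') = h'"
      using hk x by simp
    then have "x [^] (k - k') = inv h \<otimes> h'"
      using h x hk by (metis H.mem_carrier int_pow_closed inv_solve_left)
    then have xH: "x [^] (k - k') \<in> H" using h hk by simp
    have "[\<chi> h' + k' * d = (\<chi> h + \<chi> (x [^] (k - k'))) + k' * d] (mod e)"
      using hom_modD[OF \<chi> h xH] h' by (intro cong_add) auto
    also have "[(\<chi> h + \<chi> (x [^] (k - k'))) + k' * d = (\<chi> h + (k - k') * d) + k' * d] (mod e)"
      using d[OF xH] by (intro cong_add) auto
    finally show ?thesis using \<psi>' by (simp add: algebra_simps)
  qed
  have mult: "(h \<otimes> x [^] k) \<otimes> (h' \<otimes> x [^] k') = (h \<otimes> h') \<otimes> x [^] (k + k')"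
    if "h \<in> H" "h' \<in> H" for h h' and k k' :: int
    using that x by (simp add: int_pow_mult m_ac)
  have "inv (h \<otimes> x [^] k) = inv h \<otimes> x [^] (- k)" if "h \<in> H" for h and k :: int
    using that x by (simp add: int_pow_neg inv_mult)
  then have "subgroup K G"
    using x H.one_closed mult unfolding K_def
    by unfold_locales (fastforce, fastforce, (simp, metis H.one_closed int_pow_0 r_one one_closed), fastforce)
  moreover have "hom_mod e G K \<psi>"
    unfolding hom_mod_def
  proof (intro ballI)
    fix y y' assume "y \<in> K" "y' \<in> K"
    then obtain h h' and k k' :: int where h: "h \<in> H" "h' \<in> H"
      and y: "y = h \<otimes> x [^] k" "y' = h' \<otimes> x [^] k'"
      unfolding K_def by auto
    have "[\<psi> (y \<otimes> y') = \<chi> (h \<otimes> h') + (k + k') * d] (mod e)"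
      using \<psi>[of "h \<otimes> h'" "k + k'"] mult h y by simp
    also have "[\<chi> (h \<otimes> h') + (k + k') * d = (\<chi> h + \<chi> h') + (k + k') * d] (mod e)"
      using hom_modD[OF \<chi> h] by (intro cong_add) auto
    also have "(\<chi> h + \<chi> h') + (k + k') * d = (\<chi> h + k * d) + (\<chi> h' + k' * d)"
      by (simp add: algebra_simps)
    also have "[(\<chi> h + k * d) + (\<chi> h' + k' * d) = \<psi> y + \<psi> y'] (mod e)"
      using \<psi> h y by (intro cong_add) (auto intro: cong_sym)
    finally show "[\<psi> (y \<otimes> y') = \<psi> y + \<psi> y'] (mod e)" .
  qed
  moreover have HK: "[\<psi> h = \<chi> h] (mod e)" "h \<in> K" if "h \<in> H" for h
  proof -
    have eq: "h = h \<otimes> x [^] (0::int)" using that by simp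
    show "[\<psi> h = \<chi> h] (mod e)" using \<psi>[OF that, of 0] that by simp
    show "h \<in> K" unfolding K_def using eq that by blast
  qed
  moreover have "x \<in> K"
  proof -
    have "x = \<one> \<otimes> x [^] (1::int)" using x by simp
    then show ?thesis unfolding K_def using H.one_closed by blast
  qed
  moreover have "[\<psi> x = d] (mod e)"
  proof -
    have "[\<psi> x = \<chi> \<one> + d] (mod e)" using \<psi>[OF H.one_closed, of 1] x by simp
    also have "[\<chi> \<one> + d = 0 + d] (mod e)"
      using hom_mod_one[OF H \<chi>] by (intro cong_add) auto
    finally show ?thesis by simp
  qed
  ultimately show thesis using that[of K \<psi>] by blast
qed

text \<open>This is where injectivity of \<int>/e enters. With \<open>n\<close> the least positive
  exponent such that \<open>x [^] n \<in> H\<close>, one has \<open>e = n * m\<close>, and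
  \<open>m * \<chi> (x [^] n)\<close> is 0 modulo \<open>n * m\<close>. Hence \<open>n\<close>
  divides \<open>\<chi> (x [^] n)\<close>, and the quotient serves as \<open>d\<close>.\<close>

lemma hom_mod_extension_value:
  assumes e: "e > 0" "x [^] (e::nat) = \<one>"
    and H: "subgroup H G" and \<chi>: "hom_mod (int e) G H \<chi>" and x: "x \<in> carrier G"
  obtains d where "\<And>k::int. x [^] k \<in> H \<Longrightarrow> [\<chi> (x [^] k) = k * d] (mod (int e))"
proof -
  interpret H: subgroup H G by fact
  define P where "P n \<longleftrightarrow> n > 0 \<and> x [^] (n::nat) \<in> H" for n
  define n where "n = (LEAST n. P n)"
  have "P e" using e by (simp add: P_def)
  then have n: "n > 0" "x [^] n \<in> H"
    using LeastI[of P e] unfolding n_def[symmetric] by (simp_all add: P_def)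
  have powH: "y [^] (j::int) \<in> H" if "y \<in> H" for y j
    using that H subgroup_int_pow_closed by blast
  \<comment> \<open>The remainder of \<open>k\<close> modulo \<open>n\<close> is again an exponent
    whose power lies in \<open>H\<close>, so minimality of \<open>n\<close> forces it to be
    0.\<close>
  have n_dvd: "int n dvd k" if k: "x [^] k \<in> H" for k :: int
  proof -
    have "x [^] (k mod int n) = x [^] (k - int n * (k div int n))"
      by (simp add: minus_mult_div_eq_mod)
    also have "\<dots> = x [^] k \<otimes> inv ((x [^] n) [^] (k div int n))"
      using x by (simp add: int_pow_diff int_pow_pow flip: int_pow_int)
    also have "\<dots> \<in> H" using k powH[OF n(2)] by simp
    finally have "x [^] nat (k mod int n) \<in> H"
      using n by (simp flip: int_pow_int)
    moreover have "nat (k mod int n) < n" using n by (simp add: nat_less_iff)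
    then have "\<not> P (nat (k mod int n))" unfolding n_def by (rule not_less_Least)
    ultimately have "nat (k mod int n) = 0" by (simp add: P_def)
    moreover have "0 \<le> k mod int n" using n by simp
    ultimately show ?thesis by (simp add: dvd_eq_mod_eq_0)
  qed
  have "int n dvd int e" using e by (intro n_dvd) (simp add: int_pow_int)
  then obtain m where m: "e = n * m" by (metis dvdE int_dvd_int_iff)
  have "[\<chi> ((x [^] n) [^] m) = int m * \<chi> (x [^] n)] (mod (int e))"
    by (rule hom_mod_nat_pow[OF H \<chi> n(2)])
  moreover have "(x [^] n) [^] m = \<one>" using e m x by (simp add: nat_pow_pow)
  ultimately have "[int m * \<chi> (x [^] n) = 0] (mod (int e))"
    using hom_mod_one[OF H \<chi>] by (metis cong_sym cong_trans)
  \<comment> \<open>The modulus is \<open>n * m\<close> with \<open>m\<close> nonzero because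
    \<open>e > 0\<close>, so the factor \<open>m\<close> can be cancelled.\<close>
  then have "int n * int m dvd \<chi> (x [^] n) * int m" using m by (simp add: cong_0_iff mult.commute)
  then have "int n dvd \<chi> (x [^] n)" using e m by (simp add: dvd_mult_cancel_right)
  then obtain d where d: "\<chi> (x [^] n) = int n * d" by (elim dvdE)
  \<comment> \<open>Only nonnegative multiples of \<open>n\<close> at this point, since
    \<open>hom_mod_nat_pow\<close> treats natural exponents.\<close>
  have pos: "[\<chi> (x [^] (int n * int j)) = int n * int j * d] (mod (int e))" for j
    using hom_mod_nat_pow[OF H \<chi> n(2), of j] x
    by (simp add: d int_pow_int nat_pow_pow algebra_simps flip: of_nat_mult)
  show thesis
  proof (rule that)
    fix k :: int assume "x [^] k \<in> H"
    then obtain q where q: "k = int n * q" using n_dvd by (meson dvdE)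
    \<comment> \<open>Since \<open>x\<close> is killed by \<open>e\<close>, the exponent may be shifted to a nonnegative one.\<close>
    define j where "j = q mod int m"
    have "m > 0" using e m by simp
    have eq: "k = int n * j + int e * (q div int m)"
    proof -
      have "k = int n * (j + int m * (q div int m))" by (simp add: q j_def)
      then show ?thesis by (simp add: m algebra_simps)
    qed
    have "x [^] k = x [^] (int n * j) \<otimes> (x [^] e) [^] (q div int m)"
      using x unfolding eq by (simp add: int_pow_mult int_pow_pow flip: int_pow_int)
    then have "x [^] k = x [^] (int n * j)" using e x by simp
    moreover have "[\<chi> (x [^] (int n * j)) = int n * j * d] (mod (int e))"
      using pos[of "nat j"] \<open>m > 0\<close> by (simp add: j_def)
    moreover have "[int n * j * d = k * d] (mod (int e))"
      unfolding eq by (simp add: cong_iff_dvd_diff algebra_simps)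
    ultimately show "[\<chi> (x [^] k) = k * d] (mod (int e))"
      using cong_trans by metis
  qed
qed

text \<open>Adjoin elements outside the subgroup one at a time; each step strictly shrinks the
  finite complement, so induction on its cardinality reaches the whole group.\<close>

lemma hom_mod_extend_carrier:
  assumes fin: "finite (carrier G)" and e: "e > 0" "\<And>x. x \<in> carrier G \<Longrightarrow> x [^] (e::nat) = \<one>"
    and "subgroup H G" "hom_mod (int e) G H \<chi>"
  obtains \<psi> where "hom_mod (int e) G (carrier G) \<psi>" "\<And>h. h \<in> H \<Longrightarrow> [\<psi> h = \<chi> h] (mod (int e))"
proof -
  have "\<exists>\<psi>. hom_mod (int e) G (carrier G) \<psi> \<and> (\<forall>h\<in>H. [\<psi> h = \<chi> h] (mod (int e)))"
    using assms(4,5)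
  proof (induction "card (carrier G - H)" arbitrary: H \<chi> rule: less_induct)
    case less
    show ?case
    proof (cases "H = carrier G")
      case True
      then show ?thesis using less.prems by auto
    next
      case False
      then obtain x where x: "x \<in> carrier G" "x \<notin> H"
        using subgroup.subset[OF less.prems(1)] by blast
      obtain d where "\<And>k::int. x [^] k \<in> H \<Longrightarrow> [\<chi> (x [^] k) = k * d] (mod (int e))"
        using hom_mod_extension_value[OF e(1) e(2) less.prems x(1)] x(1) by blast
      then obtain K \<chi>' where K: "subgroup K G" "hom_mod (int e) G K \<chi>'" "H \<subseteq> K" "x \<in> K"
        "\<And>h. h \<in> H \<Longrightarrow> [\<chi>' h = \<chi> h] (mod (int e))"
        using hom_mod_extend[OF less.prems x(1)] by metis
      have "card (carrier G - K) < card (carrier G - H)"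
        using K x fin by (intro psubset_card_mono) auto
      from less.hyps[OF this K(1,2)] K(3,5) show ?thesis
        by (meson cong_trans subsetD)
    qed
  qed
  then show thesis using that by blast
qed

section \<open>Separating a nontrivial element from the identity\<close>

text \<open>Write \<open>e = ord a * m\<close>. The zero map on the trivial subgroup extends with
  value \<open>m\<close> at \<open>a\<close>, then to all of \<open>G\<close>. This value is nonzero
  modulo \<open>e\<close> because \<open>ord a\<close> is not 1.\<close>

lemma hom_mod_separating:
  assumes fin: "finite (carrier G)" and e: "e > 0" "\<And>x. x \<in> carrier G \<Longrightarrow> x [^] (e::nat) = \<one>"
    and a: "a \<in> carrier G" "a \<noteq> \<one>"
  obtains \<chi> where "hom_mod (int e) G (carrier G) \<chi>" "\<not> [\<chi> a = 0] (mod (int e))"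
proof -
  have "ord a dvd e" using e(2)[OF a(1)] a(1) pow_eq_id by blast
  then obtain m where m: "e = ord a * m" by (elim dvdE)
  have triv: "subgroup {\<one>} G" by (rule triv_subgroup)
  have triv_hom: "hom_mod (int e) G {\<one>} (\<lambda>_. 0)" by (simp add: hom_mod_def)
  \<comment> \<open>Compatibility of the value \<open>m\<close> with the zero map: if
    \<open>a [^] k\<close> is trivial, then \<open>ord a\<close> divides \<open>k\<close>, so
    \<open>e\<close> divides \<open>k * m\<close>.\<close>
  have "[(\<lambda>_. 0) (a [^] k) = k * int m] (mod (int e))" if "a [^] k \<in> {\<one>}" for k :: int
  proof -
    have "int (ord a) dvd k" using that a by (simp add: int_pow_eq_id)
    then have "int e dvd k * int m" unfolding m of_nat_mult by (rule mult_dvd_mono) simp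
    then show ?thesis by (simp only: cong_0_iff cong_sym_eq[of 0])
  qed
  note ext = hom_mod_extend[where \<chi> = "\<lambda>_. 0" and d = "int m", OF triv triv_hom a(1) this]
  obtain K \<chi> where K: "subgroup K G" "hom_mod (int e) G K \<chi>" "a \<in> K"
    "[\<chi> a = int m] (mod (int e))"
    by (rule ext) (assumption, rule that)
  obtain \<psi> where \<psi>: "hom_mod (int e) G (carrier G) \<psi>" "[\<psi> a = \<chi> a] (mod (int e))"
    using hom_mod_extend_carrier[OF fin e K(1,2)] K(3) by metis
  have "\<not> int e dvd int m"
  proof
    assume "int e dvd int m"
    then have "ord a * m dvd m" using m by (simp only: of_nat_dvd_iff)
    moreover have "m > 0" using e(1) m by simp
    ultimately have "ord a = 1" using dvd_mult_cancel2 by blast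
    then show False using a ord_eq_1 by simp
  qed
  then have "\<not> [\<psi> a = 0] (mod (int e))"
    using \<psi>(2) K(4) by (meson cong_0_iff cong_sym cong_trans)
  with \<psi>(1) show thesis using that by blast
qed

section \<open>Powers modulo the exponent and the resulting bilinear maps\<close>

lemma int_pow_cong:
  assumes "x \<in> carrier G" "x [^] (e::nat) = \<one>" "[i = j] (mod (int e))"
  shows "x [^] i = x [^] j"
proof -
  have "int (ord x) dvd int e" using assms pow_eq_id by auto
  then have "int (ord x) dvd i - j" using assms(3) cong_iff_dvd_diff dvd_trans by blast
  then show ?thesis using assms(1) by (metis int_pow_eq dvd_diff_commute)
qed

text \<open>Commutativity gives additivity in the base. In the argument of \<open>\<chi>\<close>,
  additivity holds only modulo \<open>e\<close>, which suffices because \<open>e\<close> kills every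
  base. The two orders of arguments serve left and right non-degeneracy.\<close>

lemma bilinear_map_hom_mod:
  assumes e: "\<And>x. x \<in> carrier G \<Longrightarrow> x [^] (e::nat) = \<one>" and \<chi>: "hom_mod (int e) G (carrier G) \<chi>"
  shows "bilinear_map G G G (\<lambda>x y. y [^] \<chi> x)" "bilinear_map G G G (\<lambda>x y. x [^] \<chi> y)"
proof -
  have "(y \<otimes> y') [^] \<chi> x = y [^] \<chi> x \<otimes> y' [^] \<chi> x" if "y \<in> carrier G" "y' \<in> carrier G" for x y y'
    using that by (simp add: int_pow_distrib)
  moreover have "y [^] \<chi> (x \<otimes> x') = y [^] \<chi> x \<otimes> y [^] \<chi> x'"
    if "x \<in> carrier G" "x' \<in> carrier G" "y \<in> carrier G" for x x' y
    using int_pow_cong[OF that(3) e[OF that(3)] hom_modD[OF \<chi> that(1,2)]] that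
    by (simp add: int_pow_mult)
  ultimately show "bilinear_map G G G (\<lambda>x y. y [^] \<chi> x)" "bilinear_map G G G (\<lambda>x y. x [^] \<chi> y)"
    unfolding bilinear_map_def by (auto intro!: homI)
qed

text \<open>The exponent is the least common multiple of the element orders. Its minimality, the
  last conclusion, ensures that an integer not divisible by \<open>e\<close> gives a power map that
  is not trivial on the group.\<close>

lemma finite_exponent:
  assumes "finite (carrier G)"
  obtains e :: nat where "e > 0" "\<And>x. x \<in> carrier G \<Longrightarrow> x [^] e = \<one>"
    "\<And>k::int. (\<And>x. x \<in> carrier G \<Longrightarrow> x [^] k = \<one>) \<Longrightarrow> int e dvd k"
proof
  let ?e = "Lcm (ord ` carrier G)"
  have "0 \<notin> ord ` carrier G" using ord_ge_1[OF assms] by force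
  then show "?e > 0" using assms by (metis Lcm_0_iff finite_imageI neq0_conv)
  show "x [^] ?e = \<one>" if "x \<in> carrier G" for x
    using that by (simp add: pow_eq_id)
  show "int ?e dvd k" if "\<And>x. x \<in> carrier G \<Longrightarrow> x [^] k = \<one>" for k :: int
  proof -
    have "ord x dvd nat \<bar>k\<bar>" if "x \<in> carrier G" for x
      using that \<open>\<And>x. x \<in> carrier G \<Longrightarrow> x [^] k = \<one>\<close>[OF that] by (simp add: int_pow_eq_id)
    then have "?e dvd nat \<bar>k\<bar>" by (intro Lcm_least) blast
    then show ?thesis by (simp only: dvd_nat_abs_iff)
  qed
qed

end

section \<open>Detecting nonzero elementary tensors\<close>

text \<open>By the universal property, \<open>f\<close> factors through a homomorphism on the tensor
  product, and homomorphisms preserve the identity. Contrapositively, a nontrivial value of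
  \<open>f\<close> certifies a nonzero elementary tensor.\<close>

lemma bilinear_map_eq_one_if_tensor:
  assumes "comm_group A" "comm_group B" "comm_group C" "bilinear_map A B C f"
    and "a \<in> carrier A" "b \<in> carrier B" "elementary_tensor A B a b = \<one>\<^bsub>tensor_product A B\<^esub>"
  shows "f a b = \<one>\<^bsub>C\<^esub>"
proof -
  interpret T: comm_group "tensor_product A B" by (rule comm_group_tensor_product[OF assms(1,2)])
  interpret C: comm_group C by fact
  obtain h where h: "h \<in> hom (tensor_product A B) C"
    and hf: "\<And>a b. a \<in> carrier A \<Longrightarrow> b \<in> carrier B \<Longrightarrow> h (elementary_tensor A B a b) = f a b"
    using tensor_product_universal[OF assms(1-4)] by blast
  have "f a b = h \<one>\<^bsub>tensor_product A B\<^esub>" using hf[OF assms(5,6)] assms(7) by simp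
  also have "\<dots> = \<one>\<^bsub>C\<^esub>" by (rule hom_one[OF h T.is_group C.is_group])
  finally show ?thesis .
qed

theorem theorem2:
  fixes A :: "('a, 'm) monoid_scheme"
  assumes "comm_group A" and "finite (carrier A)"
  shows "nondegenerate A A (tensor_product A A) (elementary_tensor A A)"
proof -
  interpret A: comm_group A by fact
  obtain e :: nat where e: "e > 0" "\<And>x. x \<in> carrier A \<Longrightarrow> x [^]\<^bsub>A\<^esub> e = \<one>\<^bsub>A\<^esub>"
    and e_dvd: "\<And>k::int. (\<And>x. x \<in> carrier A \<Longrightarrow> x [^]\<^bsub>A\<^esub> k = \<one>\<^bsub>A\<^esub>) \<Longrightarrow> int e dvd k"
    using A.finite_exponent[OF assms(2)] by blast
  note one = bilinear_map_eq_one_if_tensor[OF assms(1) assms(1) assms(1)]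
  \<comment> \<open>Common core of both sides: if all powers \<open>b [^] \<chi> a\<close> are
    trivial, then \<open>e\<close> divides \<open>\<chi> a\<close> for every \<open>\<chi>\<close>,
    whereas a nontrivial \<open>a\<close> would have a separating \<open>\<chi>\<close>.\<close>
  have sep: "a = \<one>\<^bsub>A\<^esub>"
    if a: "a \<in> carrier A" and vanish: "\<And>\<chi> b. hom_mod (int e) A (carrier A) \<chi> \<Longrightarrow> b \<in> carrier A
      \<Longrightarrow> b [^]\<^bsub>A\<^esub> \<chi> a = \<one>\<^bsub>A\<^esub>" for a
  proof (rule ccontr)
    assume "a \<noteq> \<one>\<^bsub>A\<^esub>"
    then obtain \<chi> where "hom_mod (int e) A (carrier A) \<chi>" "\<not> [\<chi> a = 0] (mod (int e))"
      using A.hom_mod_separating[OF assms(2) e a] by blast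
    then show False using vanish e_dvd by (auto simp: cong_0_iff)
  qed
  show ?thesis
    unfolding nondegenerate_def left_nondegenerate_def right_nondegenerate_def
  proof (intro conjI ballI impI)
    fix a assume "a \<in> carrier A" "\<forall>b\<in>carrier A. elementary_tensor A A a b = \<one>\<^bsub>tensor_product A A\<^esub>"
    then show "a = \<one>\<^bsub>A\<^esub>"
      \<comment> \<open>For fixed left argument \<open>a\<close>, the form that evaluates
        \<open>\<chi>\<close> on the left is used; the right-hand case uses its mirror
        image.\<close>
      by (intro sep[of a] one[OF A.bilinear_map_hom_mod(1)[OF e(2)]]) auto
  next
    fix b assume "b \<in> carrier A" "\<forall>a\<in>carrier A. elementary_tensor A A a b = \<one>\<^bsub>tensor_product A A\<^esub>"
    then show "b = \<one>\<^bsub>A\<^esub>"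
      by (intro sep[of b] one[OF A.bilinear_map_hom_mod(2)[OF e(2)]]) auto
  qed
qed

end
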